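(* Let $G$ be a finitely generated group, let $\mathcal{H}$ be a separable Hilbert space, either real or complex, and let $\pi$ be a representation of $G$ on $\mathcal{H}$ that is orthogonal if $\mathcal{H}$ is real and unitary if $\mathcal{H}$ is complex. Suppose that $\pi$ does not have almost invariant vectors and that $\mu$ is a symmetric generating measure for $G$. Then $b\mathcal{H}$ has no nonzero $\mu$-harmonic points, and in particular the action $G \curvearrowright b\mathcal{H}$ has no nonzero fixed points.
   Context: A symmetric generating measure for $G$ is a symmetric probability measure $\mu$ on $G$ (i.e. $\mu(g)=\mu(g^{-1})$) whose support is equal to a finite symmetric generating set of $G$ containing the identity. $\mathbb{T} = \mathbb{R}/\mathbb{Z}$, and $b\mathcal{H}$ is the group of all (not necessarily continuous) additive maps $\varphi \colon \mathcal{H} \to \mathbb{T}$, on which $G$ acts by $[g\varphi](v) = \varphi(\pi_g^{-1}v)$. A point $\varphi \in b\mathcal{H}$ is $\mu$-harmonic if $\varphi\left(\sum_{g}\mu(g)\pi_g v\right) = \varphi(v)$ for every $v \in \mathcal{H}$. A fixed point is $\varphi\in b\mathcal{H}$ with $g\varphi = \varphi$ for all $g \in G$. The representation $\pi$ has almost invariant vectors if there exists a sequence of unit vectors $(u_n)_n$ in $\mathcal{H}$ such that $\lim_n \Vert \pi_g u_n - u_n\Vert = 0$ for each $g \in G$. *)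

theory Defs
  imports "HOL-Algebra.Algebra" "HOL-Probability.Probability"
begin

section \<open>Complex Hilbert spaces\<close>

text \<open>
  Complex inner product spaces, with a complex inner product that is linear in its first argument.
  The axiom \<open>Re_cinner\<close> links the complex structure to the underlying real inner product space, which
  carries the norm and the topology; positivity, definiteness and the formula for the norm in terms
  of \<open>cinner\<close> follow and are proved below.
\<close>

class complex_inner = real_inner +
  fixes scaleC :: "complex \<Rightarrow> 'a \<Rightarrow> 'a"
    and cinner :: "'a \<Rightarrow> 'a \<Rightarrow> complex"
  assumes scaleC_add_right: "scaleC c (x + y) = scaleC c x + scaleC c y"
    and scaleC_add_left: "scaleC (c + d) x = scaleC c x + scaleC d x"
    and scaleC_scaleC: "scaleC c (scaleC d x) = scaleC (c * d) x"
    and scaleC_of_real: "scaleC (complex_of_real r) x = scaleR r x"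
    and cinner_commute: "cinner x y = cnj (cinner y x)"
    and cinner_add_left: "cinner (x + y) z = cinner x z + cinner y z"
    and cinner_scaleC_left: "cinner (scaleC c x) y = c * cinner x y"
    and Re_cinner: "Re (cinner x y) = inner x y"

class complex_hilbert = complex_inner + complete_space

class real_hilbert = real_inner + complete_space

lemma scaleC_one: "scaleC 1 (x::'a::complex_inner) = x"
  using scaleC_of_real[of 1 x] by simp

lemma cinner_self: "cinner x (x::'a::complex_inner) = complex_of_real ((norm x)\<^sup>2)"
proof (rule complex_eqI)
  show "Re (cinner x x) = Re (complex_of_real ((norm x)\<^sup>2))"
    by (simp add: Re_cinner power2_norm_eq_inner)
  show "Im (cinner x x) = Im (complex_of_real ((norm x)\<^sup>2))"
    using arg_cong[OF cinner_commute[of x x], of Im] by simp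
qed

lemma cinner_eq_zero_iff: "cinner x x = 0 \<longleftrightarrow> (x::'a::complex_inner) = 0"
  by (simp add: cinner_self)

lemma norm_eq_sqrt_cinner: "norm (x::'a::complex_inner) = sqrt (Re (cinner x x))"
  by (simp add: cinner_self)

instance real :: real_hilbert ..

instantiation complex :: complex_hilbert
begin
definition "scaleC c (z::complex) = c * z"
definition "cinner (z::complex) w = z * cnj w"
instance
  by standard
    (simp_all add: scaleC_complex_def cinner_complex_def algebra_simps inner_complex_def scaleR_conv_of_real)
end


section \<open>Orthogonal and unitary representations\<close>

text \<open>
  The explicit surjectivity is needed since in infinite dimensions a linear map preserving the inner
  product need not be invertible.
\<close>

definition orthogonal_group :: "('h::real_inner \<Rightarrow> 'h) monoid" where
  "orthogonal_group =
     \<lparr>carrier = {T. orthogonal_transformation T \<and> surj T}, monoid.mult = (\<circ>), one = id\<rparr>"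

definition unitary_operator :: "('h::complex_inner \<Rightarrow> 'h) \<Rightarrow> bool" where
  "unitary_operator U \<longleftrightarrow>
     (\<forall>x y. U (x + y) = U x + U y) \<and> (\<forall>c x. U (scaleC c x) = scaleC c (U x)) \<and>
     (\<forall>x y. cinner (U x) (U y) = cinner x y) \<and> surj U"

definition unitary_group :: "('h::complex_inner \<Rightarrow> 'h) monoid" where
  "unitary_group = \<lparr>carrier = {U. unitary_operator U}, monoid.mult = (\<circ>), one = id\<rparr>"

definition orthogonal_representation ::
    "('g, 'm) monoid_scheme \<Rightarrow> ('g \<Rightarrow> 'h::real_inner \<Rightarrow> 'h) \<Rightarrow> bool" where
  "orthogonal_representation G \<pi> \<longleftrightarrow> \<pi> \<in> hom G orthogonal_group"

definition unitary_representation ::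
    "('g, 'm) monoid_scheme \<Rightarrow> ('g \<Rightarrow> 'h::complex_inner \<Rightarrow> 'h) \<Rightarrow> bool" where
  "unitary_representation G \<pi> \<longleftrightarrow> \<pi> \<in> hom G unitary_group"

definition has_almost_invariant_vectors ::
    "('g, 'm) monoid_scheme \<Rightarrow> ('g \<Rightarrow> 'h::real_normed_vector \<Rightarrow> 'h) \<Rightarrow> bool" where
  "has_almost_invariant_vectors G \<pi> \<longleftrightarrow>
     (\<exists>u :: nat \<Rightarrow> 'h. (\<forall>n. norm (u n) = 1) \<and>
        (\<forall>g\<in>carrier G. (\<lambda>n. norm (\<pi> g (u n) - u n)) \<longlonglongrightarrow> 0))"

lemma group_orthogonal_group: "group (orthogonal_group :: ('h::real_inner \<Rightarrow> 'h) monoid)"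
proof (rule groupI)
  fix S T :: "'h \<Rightarrow> 'h"
  assume "S \<in> carrier orthogonal_group" "T \<in> carrier orthogonal_group"
  then show "S \<otimes>\<^bsub>orthogonal_group\<^esub> T \<in> carrier orthogonal_group"
    using comp_surj[of T S] linear_compose[of T S]
    by (simp add: orthogonal_group_def orthogonal_transformation_def o_def)
next
  fix T :: "'h \<Rightarrow> 'h"
  assume "T \<in> carrier orthogonal_group"
  then have lin: "linear T" and pres: "T v \<bullet> T w = v \<bullet> w" and surj: "surj T" for v w
    by (auto simp: orthogonal_group_def orthogonal_transformation_def)
  have "norm (T v) = norm v" for v
    by (simp add: norm_eq_sqrt_inner pres)
  then have "T v = 0 \<Longrightarrow> v = 0" for v
    by (metis norm_eq_zero)
  then have "inj T"
    using linear_injective_0[OF lin] by blast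
  define S where "S = inv_into UNIV T"
  have TS: "T (S x) = x" for x
    using surj by (simp add: S_def surj_f_inv_f)
  have ST: "S (T x) = x" for x
    using \<open>inj T\<close> by (simp add: S_def)
  have "linear S"
    by (rule linearI) (metis ST TS linear_add[OF lin], metis ST TS linear_scale[OF lin])
  moreover have "S v \<bullet> S w = v \<bullet> w" for v w
    using pres[of "S v" "S w"] by (simp add: TS)
  moreover have "surj S"
    by (metis ST surjI)
  ultimately have "S \<in> carrier orthogonal_group" "S \<otimes>\<^bsub>orthogonal_group\<^esub> T = \<one>\<^bsub>orthogonal_group\<^esub>"
    using ST by (auto simp: orthogonal_group_def orthogonal_transformation_def)
  then show "\<exists>S\<in>carrier orthogonal_group. S \<otimes>\<^bsub>orthogonal_group\<^esub> T = \<one>\<^bsub>orthogonal_group\<^esub>"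
    by blast
qed (auto simp: orthogonal_group_def orthogonal_transformation_def linear_id comp_assoc)

lemma unitary_operator_imp_orthogonal:
  assumes "unitary_operator (U::'h::complex_inner \<Rightarrow> 'h)"
  shows "orthogonal_transformation U"
proof -
  have "linear U"
    using assms by (intro linearI) (auto simp: unitary_operator_def simp flip: scaleC_of_real)
  then show ?thesis
    using assms by (simp add: unitary_operator_def orthogonal_transformation_def flip: Re_cinner)
qed

lemma group_unitary_group: "group (unitary_group :: ('h::complex_inner \<Rightarrow> 'h) monoid)"
proof (rule groupI)
  fix S T :: "'h \<Rightarrow> 'h"
  assume "S \<in> carrier unitary_group" "T \<in> carrier unitary_group"
  then show "S \<otimes>\<^bsub>unitary_group\<^esub> T \<in> carrier unitary_group"
    using comp_surj[of T S] by (simp add: unitary_group_def unitary_operator_def o_def)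
next
  fix T :: "'h \<Rightarrow> 'h"
  assume "T \<in> carrier unitary_group"
  then have U: "unitary_operator T"
    by (simp add: unitary_group_def)
  then have add: "T (x + y) = T x + T y" and scale: "T (scaleC c x) = scaleC c (T x)"
    and pres: "cinner (T x) (T y) = cinner x y" and surj: "surj T" for c x y
    by (auto simp: unitary_operator_def)
  have lin: "linear T"
    using unitary_operator_imp_orthogonal[OF U] by (simp add: orthogonal_transformation_def)
  have "norm (T v) = norm v" for v
    by (simp add: norm_eq_sqrt_cinner pres)
  then have "T v = 0 \<Longrightarrow> v = 0" for v
    by (metis norm_eq_zero)
  then have "inj T"
    using linear_injective_0[OF lin] by blast
  define S where "S = inv_into UNIV T"
  have TS: "T (S x) = x" for x
    using surj by (simp add: S_def surj_f_inv_f)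
  have ST: "S (T x) = x" for x
    using \<open>inj T\<close> by (simp add: S_def)
  have "S (x + y) = S x + S y" for x y
    by (metis ST TS add)
  moreover have "S (scaleC c x) = scaleC c (S x)" for c x
    by (metis ST TS scale)
  moreover have "cinner (S v) (S w) = cinner v w" for v w
    using pres[of "S v" "S w"] by (simp add: TS)
  moreover have "surj S"
    by (metis ST surjI)
  ultimately have "S \<in> carrier unitary_group" "S \<otimes>\<^bsub>unitary_group\<^esub> T = \<one>\<^bsub>unitary_group\<^esub>"
    using ST by (auto simp: unitary_group_def unitary_operator_def)
  then show "\<exists>S\<in>carrier unitary_group. S \<otimes>\<^bsub>unitary_group\<^esub> T = \<one>\<^bsub>unitary_group\<^esub>"
    by blast
qed (auto simp: unitary_group_def unitary_operator_def comp_assoc)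


section \<open>Symmetric generating measures\<close>

definition finitely_generated_group :: "('g, 'm) monoid_scheme \<Rightarrow> bool" where
  "finitely_generated_group G \<longleftrightarrow>
     group G \<and> (\<exists>S. finite S \<and> S \<subseteq> carrier G \<and> generate G S = carrier G)"

definition symmetric_generating_measure :: "('g, 'm) monoid_scheme \<Rightarrow> 'g pmf \<Rightarrow> bool" where
  "symmetric_generating_measure G \<mu> \<longleftrightarrow>
     (\<forall>g\<in>carrier G. pmf \<mu> g = pmf \<mu> (inv\<^bsub>G\<^esub> g)) \<and>
     finite (set_pmf \<mu>) \<and> set_pmf \<mu> \<subseteq> carrier G \<and>
     (\<forall>g\<in>set_pmf \<mu>. inv\<^bsub>G\<^esub> g \<in> set_pmf \<mu>) \<and> \<one>\<^bsub>G\<^esub> \<in> set_pmf \<mu> \<and>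
     generate G (set_pmf \<mu>) = carrier G"


section \<open>The circle group and the Bohr compactification\<close>

quotient_type circle = real / "\<lambda>x y. x - y \<in> \<int>"
proof (rule equivpI)
  show "reflp (\<lambda>x y::real. x - y \<in> \<int>)"
    by (simp add: reflp_def)
  show "symp (\<lambda>x y::real. x - y \<in> \<int>)"
  proof (rule sympI)
    fix x y :: real
    assume "x - y \<in> \<int>"
    from Ints_minus[OF this] show "y - x \<in> \<int>"
      by simp
  qed
  show "transp (\<lambda>x y::real. x - y \<in> \<int>)"
  proof (rule transpI)
    fix x y z :: real
    assume "x - y \<in> \<int>" "y - z \<in> \<int>"
    from Ints_add[OF this] show "x - z \<in> \<int>"
      by simp
  qed
qed

instantiation circle :: ab_group_add
begin

lift_definition zero_circle :: circle is 0 .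

lift_definition plus_circle :: "circle \<Rightarrow> circle \<Rightarrow> circle" is "(+)"
proof -
  fix a b c d :: real
  assume "a - b \<in> \<int>" "c - d \<in> \<int>"
  then have "(a - b) + (c - d) \<in> \<int>"
    by (rule Ints_add)
  then show "(a + c) - (b + d) \<in> \<int>"
    by (simp add: algebra_simps)
qed

lift_definition uminus_circle :: "circle \<Rightarrow> circle" is uminus
proof -
  fix a b :: real
  assume "a - b \<in> \<int>"
  from Ints_minus[OF this] show "- a - - b \<in> \<int>"
    by simp
qed

lift_definition minus_circle :: "circle \<Rightarrow> circle \<Rightarrow> circle" is "(-)"
proof -
  fix a b c d :: real
  assume "a - b \<in> \<int>" "c - d \<in> \<int>"
  then have "(a - b) - (c - d) \<in> \<int>"
    by (rule Ints_diff)
  then show "(a - c) - (b - d) \<in> \<int>"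
    by (simp add: algebra_simps)
qed

instance
  by standard (transfer; simp add: algebra_simps)+

end

text \<open>
  The elements of the Bohr compactification are all additive maps, without any continuity or
  homogeneity requirement; its zero is the constant map 0, which is \<open>\<one>\<^bsub>bohr\<^esub>\<close>
  in the multiplicative notation for groups.
\<close>

definition bohr :: "('h::ab_group_add \<Rightarrow> circle) monoid" where
  "bohr = \<lparr>carrier = {\<phi>. Modules.additive \<phi>}, monoid.mult = (\<lambda>\<phi> \<psi> v. \<phi> v + \<psi> v), one = (\<lambda>v. 0)\<rparr>"

lemma comm_group_bohr: "comm_group (bohr :: ('h::ab_group_add \<Rightarrow> circle) monoid)"
proof (rule comm_groupI)
  fix \<phi> :: "'h \<Rightarrow> circle"
  assume "\<phi> \<in> carrier bohr"
  then show "\<exists>\<psi>\<in>carrier bohr. \<psi> \<otimes>\<^bsub>bohr\<^esub> \<phi> = \<one>\<^bsub>bohr\<^esub>"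
    by (intro bexI[of _ "\<lambda>v. - \<phi> v"]) (auto simp: bohr_def Modules.additive_def)
qed (auto simp: bohr_def Modules.additive_def algebra_simps)

definition bohr_action :: "('g \<Rightarrow> 'h \<Rightarrow> 'h) \<Rightarrow> 'g \<Rightarrow> ('h \<Rightarrow> circle) \<Rightarrow> ('h \<Rightarrow> circle)" where
  "bohr_action \<pi> g \<phi> = (\<lambda>v. \<phi> (inv_into UNIV (\<pi> g) v))"

text \<open>The sum over all of the group reduces to the finite support of the measure.\<close>

definition harmonic :: "'g pmf \<Rightarrow> ('g \<Rightarrow> 'h::real_vector \<Rightarrow> 'h) \<Rightarrow> ('h \<Rightarrow> circle) \<Rightarrow> bool" where
  "harmonic \<mu> \<pi> \<phi> \<longleftrightarrow> (\<forall>v. \<phi> (\<Sum>g\<in>set_pmf \<mu>. pmf \<mu> g *\<^sub>R \<pi> g v) = \<phi> v)"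

definition fixed_point ::
    "('g, 'm) monoid_scheme \<Rightarrow> ('g \<Rightarrow> 'h \<Rightarrow> 'h) \<Rightarrow> ('h \<Rightarrow> circle) \<Rightarrow> bool" where
  "fixed_point G \<pi> \<phi> \<longleftrightarrow> (\<forall>g\<in>carrier G. bohr_action \<pi> g \<phi> = \<phi>)"

end

theory Submission
  imports Defs
begin

text \<open>
  Write \<open>M = \<Sum>g. \<mu>(g) \<pi>\<^sub>g\<close>. For a unit vector \<open>u\<close>, the \<open>\<mu>\<close>-variance of \<open>g \<mapsto> \<pi>\<^sub>g u\<close> is \<open>1 - \<parallel>M u\<parallel>\<^sup>2\<close>, so
  unit vectors with \<open>\<parallel>M u\<parallel> \<rightarrow> 1\<close> are almost invariant, because \<open>\<pi>\<^sub>g u\<close> and \<open>\<pi>\<^sub>1 u = u\<close> both become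
  close to \<open>M u\<close>. Hence without almost invariant vectors \<open>\<parallel>M\<parallel> < 1\<close> and \<open>I - M\<close> is surjective,
  while a harmonic \<open>\<phi>\<close> vanishes on its range. Fixed points are harmonic by additivity alone,
  since \<open>\<phi>(\<mu>(g) \<pi>\<^sub>g v) = \<phi>(\<mu>(g) v)\<close>.
\<close>

text \<open>Variance identity: after expanding the squares, the cross terms sum to
  \<open>-2 * (m \<bullet> m)\<close> because \<open>m\<close> is itself the weighted mean, and the
  last terms give back one \<open>m \<bullet> m\<close> because the weights have total 1.\<close>

lemma sum_weighted_dist_mean:
  fixes x :: "'i \<Rightarrow> 'a::real_inner"
  assumes "sum w A = 1" and "\<And>i. i \<in> A \<Longrightarrow> norm (x i) = 1"
  defines "m \<equiv> \<Sum>i\<in>A. w i *\<^sub>R x i"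
  shows "(\<Sum>i\<in>A. w i * (norm (x i - m))\<^sup>2) = 1 - (norm m)\<^sup>2"
proof -
  have "w i * (norm (x i - m))\<^sup>2 = w i - 2 * ((w i *\<^sub>R x i) \<bullet> m) + w i * (norm m)\<^sup>2"
    if "i \<in> A" for i
  proof -
    have "x i \<bullet> x i = 1"
      using assms(2)[OF that] by (simp add: norm_eq_1)
    then show ?thesis
      by (simp add: power2_norm_eq_inner inner_diff inner_commute algebra_simps)
  qed
  then have "(\<Sum>i\<in>A. w i * (norm (x i - m))\<^sup>2)
      = (\<Sum>i\<in>A. w i - 2 * ((w i *\<^sub>R x i) \<bullet> m) + w i * (norm m)\<^sup>2)"
    by (rule sum.cong[OF refl])
  also have "\<dots> = sum w A - 2 * (m \<bullet> m) + sum w A * (norm m)\<^sup>2"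
    unfolding m_def inner_sum_left
    by (simp add: sum.distrib sum_subtractf flip: sum_distrib_left sum_distrib_right)
  finally show ?thesis
    using assms(1) by (simp add: power2_norm_eq_inner)
qed

text \<open>A solution of \<open>x - f x = y\<close> is the same as a fixed point of
  \<open>x \<mapsto> y + f x\<close>, which is a \<open>c\<close>-contraction, so Banach's theorem
  supplies it.\<close>

lemma surj_diff_contraction:
  fixes f :: "'a::{real_normed_vector, complete_space} \<Rightarrow> 'a"
  assumes "linear f" and "0 \<le> c" "c < 1" and "\<And>x. norm (f x) \<le> c * norm x"
  shows "\<exists>x. x - f x = y"
proof -
  have "dist (y + f a) (y + f b) \<le> c * dist a b" for a b
    using assms(4)[of "a - b"] by (simp add: dist_norm linear_diff[OF assms(1)])
  then have "\<exists>!x. y + f x = x"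
    using banach_fix_type[OF assms(2,3), of "\<lambda>x. y + f x"] by blast
  then show ?thesis
    by (metis add_diff_cancel_right')
qed

lemma orthogonal_representationD:
  assumes "group G" and "orthogonal_representation G \<pi>"
  shows "g \<in> carrier G \<Longrightarrow> orthogonal_transformation (\<pi> g)"
    and "g \<in> carrier G \<Longrightarrow> h \<in> carrier G \<Longrightarrow> \<pi> (g \<otimes>\<^bsub>G\<^esub> h) v = \<pi> g (\<pi> h v)"
    and "\<pi> \<one>\<^bsub>G\<^esub> v = v"
proof -
  have hom: "\<pi> \<in> hom G orthogonal_group"
    using assms(2) by (simp add: orthogonal_representation_def)
  show "orthogonal_transformation (\<pi> g)" if "g \<in> carrier G"
    using hom_in_carrier[OF hom that] by (simp add: orthogonal_group_def)
  show "\<pi> (g \<otimes>\<^bsub>G\<^esub> h) v = \<pi> g (\<pi> h v)" if "g \<in> carrier G" "h \<in> carrier G"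
    using hom_mult[OF hom that] by (simp add: orthogonal_group_def)
  show "\<pi> \<one>\<^bsub>G\<^esub> v = v"
    using hom_one[OF hom assms(1) group_orthogonal_group] by (simp add: orthogonal_group_def)
qed

text \<open>Reduces the complex case to the real one: the norm, almost invariant vectors and
  harmonicity involve only the underlying real Hilbert space.\<close>

lemma unitary_imp_orthogonal_representation:
  "unitary_representation G \<pi> \<Longrightarrow> orthogonal_representation G \<pi>"
proof -
  assume hom: "unitary_representation G \<pi>"
  then have U: "unitary_operator (\<pi> g)" if "g \<in> carrier G" for g
    using hom_in_carrier[of \<pi> G unitary_group g] that
    by (simp add: unitary_representation_def unitary_group_def)
  then have "surj (\<pi> g)" if "g \<in> carrier G" for g
    using that by (simp add: unitary_operator_def)
  with hom U show ?thesis
    by (simp add: unitary_representation_def orthogonal_representation_def unitary_group_def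
        orthogonal_group_def hom_def Pi_iff unitary_operator_imp_orthogonal)
qed

text \<open>The elements that move \<open>u n\<close> by an amount tending to 0 are closed under
  products and inverses, because the operators are isometries. So almost invariance passes from the
  support of a generating measure to the whole group.\<close>

lemma almost_invariant_generate:
  fixes \<pi> :: "'g \<Rightarrow> 'h::real_inner \<Rightarrow> 'h"
  assumes "group G" and rep: "orthogonal_representation G \<pi>" and "S \<subseteq> carrier G"
    and S: "\<And>g. g \<in> S \<Longrightarrow> (\<lambda>n. norm (\<pi> g (u n) - u n)) \<longlonglongrightarrow> 0"
    and "h \<in> generate G S"
  shows "(\<lambda>n. norm (\<pi> h (u n) - u n)) \<longlonglongrightarrow> 0"
  using \<open>h \<in> generate G S\<close>
proof induction
  interpret group G by fact
  note repD = orthogonal_representationD[OF \<open>group G\<close> rep]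
  {
    case one
    show ?case by (simp add: repD)
  next
    case (incl h)
    then show ?case by (rule S)
  next
    case (inv h)
    then have h: "h \<in> carrier G" using \<open>S \<subseteq> carrier G\<close> by blast
    have "norm (\<pi> (inv\<^bsub>G\<^esub> h) v - v) = norm (\<pi> h v - v)" for v
    proof -
      \<comment> \<open>Applying the isometry \<open>\<pi> h\<close> turns the displacement under
        the inverse into the displacement under \<open>h\<close>, up to sign.\<close>
      have "norm (\<pi> (inv\<^bsub>G\<^esub> h) v - v) = norm (\<pi> h (\<pi> (inv\<^bsub>G\<^esub> h) v - v))"
        using repD(1)[OF h] by (simp add: orthogonal_transformation)
      also have "\<dots> = norm (v - \<pi> h v)"
        using repD(1)[OF h] repD(2)[OF h, of "inv\<^bsub>G\<^esub> h" v] h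
        by (simp add: orthogonal_transformation linear_diff repD(3))
      finally show ?thesis by (simp add: norm_minus_commute)
    qed
    then show ?case using S[OF inv] by simp
  next
    case (eng h1 h2)
    then have h: "h1 \<in> carrier G" "h2 \<in> carrier G"
      using generate_in_carrier[OF \<open>S \<subseteq> carrier G\<close>] by auto
    have "norm (\<pi> (h1 \<otimes>\<^bsub>G\<^esub> h2) v - v) \<le> norm (\<pi> h2 v - v) + norm (\<pi> h1 v - v)" for v
    proof -
      have "\<pi> (h1 \<otimes>\<^bsub>G\<^esub> h2) v - v = \<pi> h1 (\<pi> h2 v - v) + (\<pi> h1 v - v)"
        using repD(1)[OF h(1)] by (simp add: repD(2)[OF h] orthogonal_transformation linear_diff)
      also have "norm \<dots> \<le> norm (\<pi> h1 (\<pi> h2 v - v)) + norm (\<pi> h1 v - v)"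
        by (rule norm_triangle_ineq)
      finally show ?thesis
        using repD(1)[OF h(1)] by (simp add: orthogonal_transformation)
    qed
    then show ?case
      using tendsto_add[OF eng.IH(2,1)]
      by - (rule Lim_null_comparison[where
            g = "\<lambda>n. norm (\<pi> h2 (u n) - u n) + norm (\<pi> h1 (u n) - u n)"], auto)
  }
qed

text \<open>Names the average occurring in \<open>harmonic\<close>, so that harmonicity of
  \<open>\<phi>\<close> reads
  \<open>\<phi> \<circ> markov_operator \<mu> \<pi> = \<phi>\<close>.\<close>

definition markov_operator :: "'g pmf \<Rightarrow> ('g \<Rightarrow> 'h::real_vector \<Rightarrow> 'h) \<Rightarrow> 'h \<Rightarrow> 'h" where
  "markov_operator \<mu> \<pi> v = (\<Sum>g\<in>set_pmf \<mu>. pmf \<mu> g *\<^sub>R \<pi> g v)"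

lemma linear_markov_operator:
  assumes "\<And>g. g \<in> set_pmf \<mu> \<Longrightarrow> linear (\<pi> g)"
  shows "linear (markov_operator \<mu> \<pi>)"
proof (rule linearI)
  show "markov_operator \<mu> \<pi> (x + y) = markov_operator \<mu> \<pi> x + markov_operator \<mu> \<pi> y" for x y
    using assms by (simp add: markov_operator_def linear_add algebra_simps sum.distrib)
  show "markov_operator \<mu> \<pi> (c *\<^sub>R x) = c *\<^sub>R markov_operator \<mu> \<pi> x" for c x
    using assms by (simp add: markov_operator_def linear_scale scaleR_sum_right mult.commute)
qed

text \<open>A single nonnegative term of the variance is at most the whole sum; dividing by its
  positive weight gives the bound.\<close>

lemma norm_rep_diff_markov_operator:
  fixes \<pi> :: "'g \<Rightarrow> 'h::real_inner \<Rightarrow> 'h"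
  assumes "finite (set_pmf \<mu>)" and "\<And>g. g \<in> set_pmf \<mu> \<Longrightarrow> norm (\<pi> g u) = 1"
    and "g \<in> set_pmf \<mu>"
  shows "(norm (\<pi> g u - markov_operator \<mu> \<pi> u))\<^sup>2
    \<le> (1 - (norm (markov_operator \<mu> \<pi> u))\<^sup>2) / pmf \<mu> g"
proof -
  have "pmf \<mu> g * (norm (\<pi> g u - markov_operator \<mu> \<pi> u))\<^sup>2
      \<le> (\<Sum>g\<in>set_pmf \<mu>. pmf \<mu> g * (norm (\<pi> g u - markov_operator \<mu> \<pi> u))\<^sup>2)"
    by (rule member_le_sum) (use assms in auto)
  also have "\<dots> = 1 - (norm (markov_operator \<mu> \<pi> u))\<^sup>2"
    unfolding markov_operator_def
    by (rule sum_weighted_dist_mean[where w = "pmf \<mu>" and x = "\<lambda>g. \<pi> g u"])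
      (use assms sum_pmf_eq_1[of "set_pmf \<mu>" \<mu>] in auto)
  finally show ?thesis
    using pmf_positive[OF assms(3)] by (simp add: field_simps)
qed

text \<open>By contradiction: if no constant below 1 bounds the operator, normalized violating
  vectors for constants tending to 1 have variance tending to 0, and so are almost
  invariant.\<close>

lemma markov_operator_contraction:
  fixes \<pi> :: "'g \<Rightarrow> 'h::real_inner \<Rightarrow> 'h"
  assumes "group G" and \<mu>: "symmetric_generating_measure G \<mu>"
    and rep: "orthogonal_representation G \<pi>" and "\<not> has_almost_invariant_vectors G \<pi>"
  shows "\<exists>c\<ge>0. c < 1 \<and> (\<forall>v. norm (markov_operator \<mu> \<pi> v) \<le> c * norm v)"
proof (rule ccontr)
  let ?M = "markov_operator \<mu> \<pi>"
  note repD = orthogonal_representationD[OF \<open>group G\<close> rep]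
  have fin: "finite (set_pmf \<mu>)" and sub: "set_pmf \<mu> \<subseteq> carrier G"
    and one: "\<one>\<^bsub>G\<^esub> \<in> set_pmf \<mu>" and gen: "generate G (set_pmf \<mu>) = carrier G"
    using \<mu> by (auto simp: symmetric_generating_measure_def)
  have orth: "linear (\<pi> g)" "norm (\<pi> g v) = norm v" if "g \<in> set_pmf \<mu>" for g v
    using repD(1)[of g] that sub by (auto simp: orthogonal_transformation)
  have lin: "linear ?M"
    using orth(1) by (rule linear_markov_operator)
  \<comment> \<open>Candidate contraction constants increasing to 1. The shift \<open>Suc n\<close>
    makes \<open>c 0 = 0\<close>, so each lies in \<open>[0, 1)\<close>.\<close>
  define c where "c n = 1 - 1 / real (Suc n)" for n
  assume contr: "\<not> ?thesis"
  have "\<exists>v. c n * norm v < norm (?M v)" for n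
  proof -
    have "0 \<le> c n" "c n < 1" by (auto simp: c_def field_simps)
    with contr show ?thesis by (meson not_le)
  qed
  then obtain x where x: "c n * norm (x n) < norm (?M (x n))" for n
    by metis
  define u where "u n = x n /\<^sub>R norm (x n)" for n
  \<comment> \<open>At the zero vector both sides of the strict inequality \<open>x\<close> would
    vanish; hence normalization is legitimate.\<close>
  have "x n \<noteq> 0" for n
    using x[of n] by (auto simp: linear_0[OF lin])
  then have u1: "norm (u n) = 1" and uM: "c n < norm (?M (u n))" for n
    using x[of n] by (auto simp: u_def linear_scale[OF lin] field_simps)
  have c: "c \<longlonglongrightarrow> 1"
    unfolding c_def using LIMSEQ_inverse_real_of_nat_add_minus[of 1] by (simp add: inverse_eq_divide)
  have near: "(\<lambda>n. norm (\<pi> g (u n) - ?M (u n))) \<longlonglongrightarrow> 0" if g: "g \<in> set_pmf \<mu>" for g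
  proof -
    have "norm (\<pi> g (u n) - ?M (u n)) \<le> sqrt ((1 - (c n)\<^sup>2) / pmf \<mu> g)" for n
    proof (rule real_le_rsqrt)
      have "(norm (\<pi> g (u n) - ?M (u n)))\<^sup>2 \<le> (1 - (norm (?M (u n)))\<^sup>2) / pmf \<mu> g"
        using norm_rep_diff_markov_operator[OF fin _ g] orth(2) u1 by metis
      also have "\<dots> \<le> (1 - (c n)\<^sup>2) / pmf \<mu> g"
      proof -
        \<comment> \<open>Squaring preserves the inequality because \<open>c n\<close> is
          nonnegative.\<close>
        have "(c n)\<^sup>2 \<le> (norm (?M (u n)))\<^sup>2"
          using uM[of n] by (intro power_mono) (auto simp: c_def)
        then show ?thesis by (simp add: divide_right_mono)
      qed
      finally show "(norm (\<pi> g (u n) - ?M (u n)))\<^sup>2 \<le> (1 - (c n)\<^sup>2) / pmf \<mu> g" .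
    qed
    moreover have "(\<lambda>n. sqrt ((1 - (c n)\<^sup>2) / pmf \<mu> g)) \<longlonglongrightarrow> sqrt ((1 - 1\<^sup>2) / pmf \<mu> g)"
      using pmf_positive[OF g] by (intro tendsto_intros c) simp
    ultimately show ?thesis
      by - (rule Lim_null_comparison[where g = "\<lambda>n. sqrt ((1 - (c n)\<^sup>2) / pmf \<mu> g)"], auto)
  qed
  have "(\<lambda>n. norm (\<pi> g (u n) - u n)) \<longlonglongrightarrow> 0" if "g \<in> set_pmf \<mu>" for g
  proof (rule tendsto_sandwich[OF _ _ tendsto_const])
    \<comment> \<open>The second summand is \<open>near\<close> at the identity of the group: it
      lies in the support and acts trivially, so \<open>u n\<close> itself is close to
      \<open>?M (u n)\<close>.\<close>
    show "(\<lambda>n. norm (\<pi> g (u n) - ?M (u n)) + norm (u n - ?M (u n))) \<longlonglongrightarrow> 0"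
      using tendsto_add[OF near[OF that] near[OF one]] by (simp add: repD(3))
    show "\<forall>\<^sub>F n in sequentially.
        norm (\<pi> g (u n) - u n) \<le> norm (\<pi> g (u n) - ?M (u n)) + norm (u n - ?M (u n))"
      by (intro always_eventually allI) (metis dist_norm dist_triangle2)
  qed simp
  then have "(\<lambda>n. norm (\<pi> g (u n) - u n)) \<longlonglongrightarrow> 0" if "g \<in> carrier G" for g
    using almost_invariant_generate[OF \<open>group G\<close> rep sub] that gen by blast
  with u1 have "has_almost_invariant_vectors G \<pi>"
    unfolding has_almost_invariant_vectors_def by blast
  with assms(4) show False by contradiction
qed

lemma fixed_point_imp_harmonic:
  fixes \<pi> :: "'g \<Rightarrow> 'h::real_inner \<Rightarrow> 'h"
  assumes "group G" and "finite (set_pmf \<mu>)" and sub: "set_pmf \<mu> \<subseteq> carrier G"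
    and rep: "orthogonal_representation G \<pi>"
    and add: "Modules.additive \<phi>" and fixed: "fixed_point G \<pi> \<phi>"
  shows "harmonic \<mu> \<pi> \<phi>"
  unfolding harmonic_def
proof
  fix v
  have inv: "\<phi> (\<pi> g w) = \<phi> w" and lin: "linear (\<pi> g)" if "g \<in> set_pmf \<mu>" for g w
  proof -
    have g: "g \<in> carrier G" using that sub by blast
    have orth: "orthogonal_transformation (\<pi> g)"
      using orthogonal_representationD(1)[OF assms(1) rep g] .
    then show "linear (\<pi> g)" by (simp add: orthogonal_transformation)
    have "inj (\<pi> g)"
      using orth by (rule orthogonal_transformation_inj)
    \<comment> \<open>The action precomposes with the inverse operator, so invariance is evaluated
      at \<open>\<pi> g w\<close>, where injectivity cancels the inverse.\<close>
    moreover have "\<phi> (inv_into UNIV (\<pi> g) (\<pi> g w)) = \<phi> (\<pi> g w)"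
      using fixed g unfolding fixed_point_def bohr_action_def by metis
    ultimately show "\<phi> (\<pi> g w) = \<phi> w" by simp
  qed
  have "\<phi> (\<Sum>g\<in>set_pmf \<mu>. pmf \<mu> g *\<^sub>R \<pi> g v) = (\<Sum>g\<in>set_pmf \<mu>. \<phi> (pmf \<mu> g *\<^sub>R \<pi> g v))"
    by (rule additive.sum[OF add])
  \<comment> \<open>Since \<open>\<phi>\<close> is only additive, the real weight cannot be pulled
    out of it. Instead the weight moves inside the linear map \<open>\<pi> g\<close>, and invariance
    is applied to the scaled vector.\<close>
  also have "\<dots> = (\<Sum>g\<in>set_pmf \<mu>. \<phi> (pmf \<mu> g *\<^sub>R v))"
    by (rule sum.cong[OF refl]) (metis inv lin linear_scale)
  also have "\<dots> = \<phi> (\<Sum>g\<in>set_pmf \<mu>. pmf \<mu> g *\<^sub>R v)"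
    by (rule additive.sum[OF add, symmetric])
  also have "(\<Sum>g\<in>set_pmf \<mu>. pmf \<mu> g *\<^sub>R v) = v"
    using sum_pmf_eq_1[OF assms(2), of \<mu>] by (simp flip: scaleR_left.sum)
  finally show "\<phi> (\<Sum>g\<in>set_pmf \<mu>. pmf \<mu> g *\<^sub>R \<pi> g v) = \<phi> v" .
qed

text \<open>Common core of both cases: the sort \<open>{real_inner, complete_space}\<close> covers
  \<open>real_hilbert\<close> and \<open>complex_hilbert\<close> alike.\<close>

lemma bohr_harmonic_and_fixed_trivial:
  fixes \<pi> :: "'g \<Rightarrow> 'h::{real_inner, complete_space} \<Rightarrow> 'h"
  assumes "group G" and \<mu>: "symmetric_generating_measure G \<mu>"
    and rep: "orthogonal_representation G \<pi>" and "\<not> has_almost_invariant_vectors G \<pi>"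
    and "\<phi> \<in> carrier bohr"
  shows "harmonic \<mu> \<pi> \<phi> \<Longrightarrow> \<phi> = \<one>\<^bsub>bohr\<^esub>" and "fixed_point G \<pi> \<phi> \<Longrightarrow> \<phi> = \<one>\<^bsub>bohr\<^esub>"
proof -
  have fin: "finite (set_pmf \<mu>)" and sub: "set_pmf \<mu> \<subseteq> carrier G"
    using \<mu> by (auto simp: symmetric_generating_measure_def)
  have add: "Modules.additive \<phi>"
    using assms(5) by (simp add: bohr_def)
  have lin: "linear (markov_operator \<mu> \<pi>)"
    using orthogonal_representationD(1)[OF \<open>group G\<close> rep] sub
    by (intro linear_markov_operator) (auto simp: orthogonal_transformation)
  obtain c where c: "0 \<le> c" "c < 1" "\<And>v. norm (markov_operator \<mu> \<pi> v) \<le> c * norm v"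
    using markov_operator_contraction[OF assms(1-4)] by blast
  show *: "\<phi> = \<one>\<^bsub>bohr\<^esub>" if "harmonic \<mu> \<pi> \<phi>"
  proof
    fix y
    \<comment> \<open>Writing an arbitrary \<open>y\<close> in this form gives, by additivity,
      \<open>\<phi> y\<close> as the difference of two values that harmonicity makes equal.\<close>
    obtain x where "x - markov_operator \<mu> \<pi> x = y"
      using surj_diff_contraction[OF lin c] by blast
    moreover have "\<phi> (markov_operator \<mu> \<pi> x) = \<phi> x"
      using that by (simp add: harmonic_def markov_operator_def)
    ultimately show "\<phi> y = \<one>\<^bsub>bohr\<^esub> y"
      using additive.diff[OF add, of x "markov_operator \<mu> \<pi> x"] by (simp add: bohr_def)
  qed
  show "\<phi> = \<one>\<^bsub>bohr\<^esub>" if "fixed_point G \<pi> \<phi>"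
    using * fixed_point_imp_harmonic[OF \<open>group G\<close> fin sub rep add that] by blast
qed

theorem proposition4:
  fixes G :: "('g, 'm) monoid_scheme"
    and \<mu> :: "'g pmf"
  assumes "finitely_generated_group G"
    and "symmetric_generating_measure G \<mu>"
  shows
    "(\<forall>\<pi> :: 'g \<Rightarrow> 'r::real_hilbert \<Rightarrow> 'r.
        separable_space (euclidean :: 'r topology) \<longrightarrow>
        orthogonal_representation G \<pi> \<longrightarrow>
        \<not> has_almost_invariant_vectors G \<pi> \<longrightarrow>
          (\<forall>\<phi>\<in>carrier bohr. harmonic \<mu> \<pi> \<phi> \<longrightarrow> \<phi> = \<one>\<^bsub>bohr\<^esub>) \<and>
          (\<forall>\<phi>\<in>carrier bohr. fixed_point G \<pi> \<phi> \<longrightarrow> \<phi> = \<one>\<^bsub>bohr\<^esub>)) \<and>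
     (\<forall>\<pi> :: 'g \<Rightarrow> 'c::complex_hilbert \<Rightarrow> 'c.
        separable_space (euclidean :: 'c topology) \<longrightarrow>
        unitary_representation G \<pi> \<longrightarrow>
        \<not> has_almost_invariant_vectors G \<pi> \<longrightarrow>
          (\<forall>\<phi>\<in>carrier bohr. harmonic \<mu> \<pi> \<phi> \<longrightarrow> \<phi> = \<one>\<^bsub>bohr\<^esub>) \<and>
          (\<forall>\<phi>\<in>carrier bohr. fixed_point G \<pi> \<phi> \<longrightarrow> \<phi> = \<one>\<^bsub>bohr\<^esub>))"
proof -
  have "group G"
    using assms(1) by (simp add: finitely_generated_group_def)
  note trivial = bohr_harmonic_and_fixed_trivial[OF this assms(2)]
  show ?thesis
    by (intro conjI allI impI ballI)
      (blast intro: trivial dest: unitary_imp_orthogonal_representation)+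
qed

end
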